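(* Every subset of $2^{\mathbb{N}}$ which is perfectly meager in the transitive sense is countably perfectly meager in $2^{\mathbb{N}}$.
   Context: $2^{\mathbb{N}}$ is the Cantor space, with coordinatewise addition modulo $2$ as group operation; $P+t=\{p+t:p\in P\}$. A perfect set is a non-empty closed set with no isolated points. A set $A\subseteq 2^{\mathbb{N}}$ is perfectly meager in the transitive sense if for every perfect subset $P$ of $2^{\mathbb{N}}$ there exists an $F_\sigma$-set $F$ in $2^{\mathbb{N}}$ such that $A\subseteq F$ and $F\cap(P+t)$ is meager in $P+t$ for each $t\in 2^{\mathbb{N}}$. A set $A\subseteq 2^{\mathbb{N}}$ is countably perfectly meager in $2^{\mathbb{N}}$ if for every sequence $\{P_n : n\in\mathbb{N}\}$ of perfect subsets of $2^{\mathbb{N}}$ there exists an $F_\sigma$-set $F$ in $2^{\mathbb{N}}$ such that $A\subseteq F$ and $F\cap P_n$ is meager in $P_n$ for each $n$. *)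

theory Defs
  imports
    "HOL-Analysis.Analysis"
    "HOL-Library.Z2"
    "HOL-Library.Function_Algebras"
begin

text \<open>
  Points of the Cantor space are sequences of type \<^typ>\<open>nat \<Rightarrow> bit\<close>. Addition on
  \<^typ>\<open>bit\<close> is addition modulo 2, so the pointwise addition of
  \<^theory>\<open>HOL-Library.Function_Algebras\<close> is the group operation.
\<close>

definition cantor_space :: "(nat \<Rightarrow> bit) topology" where
  "cantor_space = product_topology (\<lambda>_. discrete_topology UNIV) UNIV"

definition translate :: "(nat \<Rightarrow> bit) set \<Rightarrow> (nat \<Rightarrow> bit) \<Rightarrow> (nat \<Rightarrow> bit) set" where
  "translate P t = {p + t | p. p \<in> P}"

definition nowhere_dense_in :: "'a topology \<Rightarrow> 'a set \<Rightarrow> bool" where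
  "nowhere_dense_in X S \<longleftrightarrow> S \<subseteq> topspace X \<and> X interior_of (X closure_of S) = {}"

definition meager_in :: "'a topology \<Rightarrow> 'a set \<Rightarrow> bool" where
  "meager_in X = countable union_of nowhere_dense_in X"

definition perfect_in :: "'a topology \<Rightarrow> 'a set \<Rightarrow> bool" where
  "perfect_in X P \<longleftrightarrow>
     P \<noteq> {} \<and> closedin X P \<and> (\<forall>x\<in>P. \<not> openin (subtopology X P) {x})"

definition perfectly_meager_transitive :: "(nat \<Rightarrow> bit) set \<Rightarrow> bool" where
  "perfectly_meager_transitive A \<longleftrightarrow>
     (\<forall>P. perfect_in cantor_space P \<longrightarrow>
        (\<exists>F. fsigma_in cantor_space F \<and> A \<subseteq> F \<and>
             (\<forall>t. meager_in (subtopology cantor_space (translate P t)) (F \<inter> translate P t))))"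

definition countably_perfectly_meager :: "(nat \<Rightarrow> bit) set \<Rightarrow> bool" where
  "countably_perfectly_meager A \<longleftrightarrow>
     (\<forall>P :: nat \<Rightarrow> (nat \<Rightarrow> bit) set. (\<forall>n. perfect_in cantor_space (P n)) \<longrightarrow>
        (\<exists>F. fsigma_in cantor_space F \<and> A \<subseteq> F \<and>
             (\<forall>n. meager_in (subtopology cantor_space (P n)) (F \<inter> P n))))"

end

theory Submission
  imports Defs
begin

text \<open>
  Write \<open>[x|k]\<close> for the cylinder of all sequences that agree with \<open>x\<close> below \<open>k\<close>.
  Transitive perfect meagerness handles one perfect set at a time, but all of its translates
  at once.  So, given perfect sets \<open>P n\<close>, one perfect set \<open>Q\<close> is built that contains
  translates of enough pieces of all the \<open>P n\<close>; the \<open>F\<^sub>\<sigma>\<close>-set that belongs to \<open>Q\<close> then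
  serves every \<open>P n\<close>.

  Let \<open>e i\<close> be the sequence whose only 1 is at \<open>i\<close>.  The cylinders \<open>[e i|i + 1]\<close> partition the
  nonzero sequences and converge to 0.  Choose a sequence of pairs \<open>(m i, x i)\<close> with
  \<open>x i \<in> P (m i)\<close> such that for every \<open>n\<close> the points \<open>x i\<close> with \<open>m i = n\<close> are dense in \<open>P n\<close>.
  The translation by \<open>x i + e i\<close> moves \<open>P (m i) \<inter> [x i|i + 1]\<close> into \<open>[e i|i + 1]\<close>, and \<open>Q\<close>
  consists of these translates together with the point 0 (\<open>perfect_in_glue\<close>).

  If \<open>F\<close> is meager in all translates of \<open>Q\<close>, translating back shows that \<open>F\<close> is meager in the
  open piece \<open>P (m i) \<inter> [x i|i + 1]\<close> of \<open>P (m i)\<close>, because meagerness is local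
  (\<open>meager_in_local\<close>).  The pieces shrink with \<open>i\<close> and need not cover \<open>P n\<close>, but those with
  \<open>m i = n\<close> have a dense union in \<open>P n\<close>, and what is left out is nowhere dense
  (\<open>meager_in_from_dense_cover\<close>).
\<close>

section \<open>Locality of meagerness\<close>

lemma nowhere_dense_in_iff:
  "nowhere_dense_in X S \<longleftrightarrow> S \<subseteq> topspace X \<and>
     (\<forall>V. openin X V \<and> V \<noteq> {} \<longrightarrow> (\<exists>W. openin X W \<and> W \<noteq> {} \<and> W \<subseteq> V \<and> W \<inter> S = {}))"
  (is "?L \<longleftrightarrow> ?R")
proof
  assume L: ?L
  have "\<exists>W. openin X W \<and> W \<noteq> {} \<and> W \<subseteq> V \<and> W \<inter> S = {}" if V: "openin X V" "V \<noteq> {}" for V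
  proof (intro exI conjI)
    show "openin X (V - X closure_of S)"
      using V by (simp add: openin_diff)
    show "V - X closure_of S \<noteq> {}"
      using L V interior_of_maximal[of V "X closure_of S" X] by (auto simp: nowhere_dense_in_def)
    show "(V - X closure_of S) \<inter> S = {}"
      using L closure_of_subset[of S X] by (auto simp: nowhere_dense_in_def)
  qed auto
  with L show ?R by (auto simp: nowhere_dense_in_def)
next
  assume R: ?R
  have "X interior_of (X closure_of S) = {}"
  proof (rule ccontr)
    assume "X interior_of (X closure_of S) \<noteq> {}"
    with R obtain W where W: "openin X W" "W \<noteq> {}" "W \<subseteq> X interior_of (X closure_of S)"
      "W \<inter> S = {}"
      by (meson openin_interior_of)
    then have "W \<inter> X closure_of S = {}"
      by (simp add: openin_Int_closure_of_eq_empty)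
    with W interior_of_subset[of X "X closure_of S"] show False by blast
  qed
  with R show ?L by (auto simp: nowhere_dense_in_def)
qed

text \<open>
  Inside the open set \<open>G\<close> the subspaces \<open>A\<close> and \<open>B\<close> have the same open subsets.  Hence an open
  set of \<open>B\<close> that meets \<open>G\<close> can be shrunk within \<open>G\<close> to avoid \<open>S\<close>, and one that does not
  meet \<open>G\<close> already avoids \<open>S \<inter> G\<close>.
\<close>

lemma nowhere_dense_in_local:
  assumes S: "nowhere_dense_in (subtopology X A) S" and G: "openin X G" and eq: "A \<inter> G = B \<inter> G"
  shows "nowhere_dense_in (subtopology X B) (S \<inter> G)"
  unfolding nowhere_dense_in_iff
proof (intro conjI allI impI)
  show "S \<inter> G \<subseteq> topspace (subtopology X B)"
    using S eq by (auto simp: nowhere_dense_in_iff)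
next
  fix V assume "openin (subtopology X B) V \<and> V \<noteq> {}"
  then obtain V' where V': "openin X V'" "V = V' \<inter> B" and ne: "V \<noteq> {}"
    by (auto simp: openin_subtopology)
  show "\<exists>W. openin (subtopology X B) W \<and> W \<noteq> {} \<and> W \<subseteq> V \<and> W \<inter> (S \<inter> G) = {}"
  proof (cases "V \<inter> G = {}")
    case True
    with V' ne show ?thesis
      by (intro exI[of _ V]) (auto simp: openin_subtopology)
  next
    case False
    have "V \<inter> G = (V' \<inter> G) \<inter> A"
      using V' eq by blast
    then have "openin (subtopology X A) (V \<inter> G)"
      using V' G by (auto simp: openin_subtopology)
    with False S obtain W where W: "openin (subtopology X A) W" "W \<noteq> {}" "W \<subseteq> V \<inter> G"
      "W \<inter> S = {}"
      unfolding nowhere_dense_in_iff by meson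
    then obtain W' where W': "openin X W'" "W = W' \<inter> A"
      by (auto simp: openin_subtopology)
    have "W = (W' \<inter> G) \<inter> B"
      using W W' eq by blast
    then have "openin (subtopology X B) W"
      using W' G by (auto simp: openin_subtopology)
    with W show ?thesis by blast
  qed
qed

lemma meager_in_local:
  assumes S: "meager_in (subtopology X A) S" and G: "openin X G" and eq: "A \<inter> G = B \<inter> G"
  shows "meager_in (subtopology X B) (S \<inter> G)"
proof -
  obtain \<U> where \<U>: "countable \<U>" "\<U> \<subseteq> Collect (nowhere_dense_in (subtopology X A))" "\<Union>\<U> = S"
    using S by (auto simp: meager_in_def union_of_def)
  have "(\<lambda>U. U \<inter> G) ` \<U> \<subseteq> Collect (nowhere_dense_in (subtopology X B))"
    using \<U> nowhere_dense_in_local[OF _ G eq] by blast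
  moreover have "\<Union>((\<lambda>U. U \<inter> G) ` \<U>) = S \<inter> G"
    using \<U> by blast
  ultimately show ?thesis
    using \<U> unfolding meager_in_def union_of_def by (metis countable_image)
qed

text \<open>
  The union of the \<open>G i\<close> is open and dense, so the part of \<open>M\<close> outside it is nowhere dense;
  the part inside is a countable union of meager sets.
\<close>

lemma meager_in_from_dense_cover:
  assumes M: "M \<subseteq> topspace X"
    and I: "countable I"
    and op: "\<And>i. i \<in> I \<Longrightarrow> openin X (G i)"
    and meager: "\<And>i. i \<in> I \<Longrightarrow> meager_in X (M \<inter> G i)"
    and dense: "\<And>V. openin X V \<Longrightarrow> V \<noteq> {} \<Longrightarrow> \<exists>i\<in>I. V \<inter> G i \<noteq> {}"
  shows "meager_in X M"
proof -
  have "nowhere_dense_in X (M - \<Union>(G ` I))"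
    unfolding nowhere_dense_in_iff
  proof (intro conjI allI impI)
    fix V assume V: "openin X V \<and> V \<noteq> {}"
    then obtain i where i: "i \<in> I" "V \<inter> G i \<noteq> {}"
      using dense by blast
    then show "\<exists>W. openin X W \<and> W \<noteq> {} \<and> W \<subseteq> V \<and> W \<inter> (M - \<Union>(G ` I)) = {}"
      using V op by (intro exI[of _ "V \<inter> G i"]) auto
  qed (use M in auto)
  then have "meager_in X (M - \<Union>(G ` I))"
    unfolding meager_in_def by (simp add: countable_union_of_inc)
  moreover have "meager_in X (\<Union>((\<lambda>i. M \<inter> G i) ` I))"
    unfolding meager_in_def
    by (rule countable_union_of_Union) (use I meager in \<open>auto simp: meager_in_def\<close>)
  ultimately have "meager_in X ((M - \<Union>(G ` I)) \<union> \<Union>((\<lambda>i. M \<inter> G i) ` I))"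
    unfolding meager_in_def by (rule countable_union_of_Un)
  moreover have "(M - \<Union>(G ` I)) \<union> \<Union>((\<lambda>i. M \<inter> G i) ` I) = M"
    by blast
  ultimately show ?thesis by simp
qed

section \<open>Cylinders and translations of the Cantor space\<close>

definition cylinder :: "(nat \<Rightarrow> bit) \<Rightarrow> nat \<Rightarrow> (nat \<Rightarrow> bit) set" where
  "cylinder x k = {y. \<forall>j<k. y j = x j}"

lemma cylinder_self [simp]: "x \<in> cylinder x k"
  by (simp add: cylinder_def)

lemma cylinder_mono: "k \<le> l \<Longrightarrow> cylinder x l \<subseteq> cylinder x k"
  by (auto simp: cylinder_def)

lemma cylinder_subset: "y \<in> cylinder x k \<Longrightarrow> k \<le> l \<Longrightarrow> cylinder y l \<subseteq> cylinder x k"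
  by (auto simp: cylinder_def)

lemma openin_cantor_space_iff:
  "openin cantor_space U \<longleftrightarrow> (\<forall>x\<in>U. \<exists>k. cylinder x k \<subseteq> U)"
proof
  assume U: "openin cantor_space U"
  show "\<forall>x\<in>U. \<exists>k. cylinder x k \<subseteq> U"
  proof
    fix x assume "x \<in> U"
    then obtain B where B: "finite {i. B i \<noteq> UNIV}" "x \<in> Pi\<^sub>E UNIV B" "Pi\<^sub>E UNIV B \<subseteq> U"
      using U unfolding cantor_space_def openin_product_topology_alt by auto
    obtain k where k: "\<And>i. B i \<noteq> UNIV \<Longrightarrow> i < k"
      using B(1) unfolding finite_nat_set_iff_bounded by auto
    have "cylinder x k \<subseteq> Pi\<^sub>E UNIV B"
    proof
      fix y assume y: "y \<in> cylinder x k"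
      have "y i \<in> B i" for i
        using k[of i] y B(2) by (cases "B i = UNIV") (auto simp: cylinder_def)
      then show "y \<in> Pi\<^sub>E UNIV B" by auto
    qed
    with B show "\<exists>k. cylinder x k \<subseteq> U" by blast
  qed
next
  assume R: "\<forall>x\<in>U. \<exists>k. cylinder x k \<subseteq> U"
  show "openin cantor_space U"
    unfolding cantor_space_def openin_product_topology_alt
  proof
    fix x assume "x \<in> U"
    with R obtain k where k: "cylinder x k \<subseteq> U" by blast
    define B where "B i = (if i < k then {x i} else UNIV)" for i
    have "{i. B i \<noteq> UNIV} \<subseteq> {..<k}"
      by (auto simp: B_def)
    then have "finite {i. B i \<noteq> UNIV}"
      by (rule finite_subset) simp
    moreover have "Pi\<^sub>E UNIV B = cylinder x k"
      by (auto simp: B_def cylinder_def PiE_iff split: if_splits)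
    ultimately show "\<exists>B. finite {i \<in> UNIV. B i \<noteq> topspace (discrete_topology UNIV)} \<and>
        (\<forall>i\<in>UNIV. openin (discrete_topology UNIV) (B i)) \<and> x \<in> Pi\<^sub>E UNIV B \<and> Pi\<^sub>E UNIV B \<subseteq> U"
      using k by (intro exI[of _ B]) auto
  qed
qed

lemma topspace_cantor_space [simp]: "topspace cantor_space = UNIV"
  by (simp add: cantor_space_def)

lemma openin_cylinder: "openin cantor_space (cylinder x k)"
  unfolding openin_cantor_space_iff by (meson cylinder_subset order_refl)

lemma closedin_cantor_space_iff:
  "closedin cantor_space S \<longleftrightarrow> (\<forall>x. (\<forall>k. cylinder x k \<inter> S \<noteq> {}) \<longrightarrow> x \<in> S)"
proof -
  have "closedin cantor_space S \<longleftrightarrow> (\<forall>x\<in>- S. \<exists>k. cylinder x k \<subseteq> - S)"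
    by (simp add: closedin_def Compl_eq_Diff_UNIV openin_cantor_space_iff)
  then show ?thesis
    by (simp add: disjoint_eq_subset_Compl) blast
qed

lemma perfect_in_cantor_space_iff:
  "perfect_in cantor_space P \<longleftrightarrow>
     P \<noteq> {} \<and> closedin cantor_space P \<and> (\<forall>x\<in>P. \<forall>k. \<exists>y\<in>P \<inter> cylinder x k. y \<noteq> x)"
proof -
  have "openin (subtopology cantor_space P) {x} \<longleftrightarrow> (\<exists>k. P \<inter> cylinder x k \<subseteq> {x})"
    if "x \<in> P" for x
  proof
    assume "openin (subtopology cantor_space P) {x}"
    then obtain U where U: "openin cantor_space U" "{x} = U \<inter> P"
      by (auto simp: openin_subtopology)
    then obtain k where "cylinder x k \<subseteq> U"
      unfolding openin_cantor_space_iff by blast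
    with U show "\<exists>k. P \<inter> cylinder x k \<subseteq> {x}" by blast
  next
    assume "\<exists>k. P \<inter> cylinder x k \<subseteq> {x}"
    then obtain k where "P \<inter> cylinder x k \<subseteq> {x}" ..
    with that have "{x} = cylinder x k \<inter> P" by auto
    then show "openin (subtopology cantor_space P) {x}"
      using openin_cylinder by (auto simp: openin_subtopology)
  qed
  then show ?thesis
    unfolding perfect_in_def by blast
qed

text \<open>Every element is its own inverse, so translating by \<open>t\<close> twice changes nothing.\<close>

lemma bit_add_self [simp]: "a + a = (0::bit)"
  by (cases a) auto

lemma cantor_add_cancel [simp]: "x + t + t = (x :: nat \<Rightarrow> bit)"
  by (rule ext) (simp add: add.assoc)

lemma mem_translate_iff: "z \<in> translate S t \<longleftrightarrow> z + t \<in> S"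
  unfolding translate_def by (auto) (metis cantor_add_cancel)

lemma add_mem_cylinder_iff: "y + t \<in> cylinder (x + t) k \<longleftrightarrow> y \<in> cylinder x k"
  by (simp only: cylinder_def mem_Collect_eq plus_fun_apply add_right_cancel)

lemma perfect_in_translate:
  assumes "perfect_in cantor_space P"
  shows "perfect_in cantor_space (translate P t)"
  unfolding perfect_in_cantor_space_iff closedin_cantor_space_iff
proof (intro conjI allI impI ballI)
  show "translate P t \<noteq> {}"
    using assms by (auto simp: perfect_in_def translate_def)
next
  fix x assume x: "\<forall>k. cylinder x k \<inter> translate P t \<noteq> {}"
  have "cylinder (x + t) k \<inter> P \<noteq> {}" for k
  proof -
    obtain y where "y \<in> cylinder x k" "y + t \<in> P"
      using x mem_translate_iff by (meson disjoint_iff)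
    then show ?thesis
      using add_mem_cylinder_iff by blast
  qed
  then show "x \<in> translate P t"
    using assms by (auto simp: perfect_in_def closedin_cantor_space_iff mem_translate_iff)
next
  fix x k assume "x \<in> translate P t"
  then obtain y where y: "y \<in> P" "y \<in> cylinder (x + t) k" "y \<noteq> x + t"
    using assms by (auto simp: perfect_in_cantor_space_iff mem_translate_iff)
  have "y + t \<in> translate P t"
    using y by (simp add: mem_translate_iff)
  moreover have "y + t \<in> cylinder x k"
    using y(2) add_mem_cylinder_iff[of "y + t" t x k] by simp
  moreover have "y + t \<noteq> x"
    using y(3) by (metis cantor_add_cancel)
  ultimately show "\<exists>y\<in>translate P t \<inter> cylinder x k. y \<noteq> x"
    by blast
qed

section \<open>Gluing perfect sets together\<close>

definition unit_seq :: "nat \<Rightarrow> nat \<Rightarrow> bit" where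
  "unit_seq i = (\<lambda>j. if j = i then 1 else 0)"

abbreviation ring_cylinder :: "nat \<Rightarrow> (nat \<Rightarrow> bit) set" where
  "ring_cylinder i \<equiv> cylinder (unit_seq i) (Suc i)"

lemma mem_ring_cylinder_iff: "z \<in> ring_cylinder i \<longleftrightarrow> (\<forall>j<i. z j = 0) \<and> z i = 1"
  by (auto simp: cylinder_def unit_seq_def less_Suc_eq)

lemma ring_cylinder_unique: "z \<in> ring_cylinder i \<Longrightarrow> z \<in> ring_cylinder j \<Longrightarrow> i = j"
  unfolding mem_ring_cylinder_iff by (metis linorder_neqE_nat zero_neq_one)

lemma ex_ring_cylinder:
  assumes "z \<noteq> 0"
  shows "\<exists>i. z \<in> ring_cylinder i"
proof -
  have "\<exists>i. z i \<noteq> 0"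
    using assms by (auto simp: fun_eq_iff)
  then have "z (LEAST i. z i \<noteq> 0) \<noteq> 0"
    by (rule LeastI_ex)
  then show ?thesis
    unfolding mem_ring_cylinder_iff using not_less_Least
    by (metis (mono_tags, lifting) bit_not_zero_iff)
qed

lemma zero_notin_ring_cylinder: "0 \<notin> ring_cylinder i"
  by (simp add: mem_ring_cylinder_iff)

definition glue :: "(nat \<Rightarrow> (nat \<Rightarrow> bit) set) \<Rightarrow> (nat \<Rightarrow> bit) set" where
  "glue K = insert 0 (\<Union>i. K i \<inter> ring_cylinder i)"

lemma glue_Int_ring_cylinder: "glue K \<inter> ring_cylinder i = K i \<inter> ring_cylinder i"
  unfolding glue_def using ring_cylinder_unique zero_notin_ring_cylinder by blast

text \<open>
  Each \<open>ring_cylinder i\<close> is open and sees only \<open>K i\<close>, so away from 0 both closedness and the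
  absence of isolated points are inherited from the sets \<open>K i\<close>.  At 0 closedness holds
  because 0 is included, and 0 is not isolated because it is the limit of \<open>unit_seq i \<in> K i\<close>.
\<close>

lemma perfect_in_glue:
  assumes K: "\<And>i. perfect_in cantor_space (K i)" and e: "\<And>i. unit_seq i \<in> K i"
  shows "perfect_in cantor_space (glue K)"
  unfolding perfect_in_cantor_space_iff closedin_cantor_space_iff
proof (intro conjI allI impI ballI)
  show "glue K \<noteq> {}"
    by (simp add: glue_def)
next
  fix x assume x: "\<forall>k. cylinder x k \<inter> glue K \<noteq> {}"
  show "x \<in> glue K"
  proof (cases "x = 0")
    case True
    then show ?thesis by (simp add: glue_def)
  next
    case False
    then obtain i where i: "x \<in> ring_cylinder i"
      using ex_ring_cylinder by blast
    have "cylinder x k \<inter> K i \<noteq> {}" for k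
    proof -
      have "cylinder x (max k (Suc i)) \<inter> glue K \<noteq> {}"
        using x by blast
      moreover have "cylinder x (max k (Suc i)) \<subseteq> ring_cylinder i"
        using i by (rule cylinder_subset) simp
      moreover have "cylinder x (max k (Suc i)) \<subseteq> cylinder x k"
        by (rule cylinder_mono) simp
      ultimately show ?thesis
        using glue_Int_ring_cylinder[of K i] by blast
    qed
    then have "x \<in> K i"
      using K[of i] by (auto simp: perfect_in_def closedin_cantor_space_iff)
    with i show ?thesis
      using glue_Int_ring_cylinder by blast
  qed
next
  fix x k assume x: "x \<in> glue K"
  show "\<exists>y\<in>glue K \<inter> cylinder x k. y \<noteq> x"
  proof (cases "x = 0")
    case True
    have "unit_seq k \<in> glue K"
      using e[of k] cylinder_self unfolding glue_def by blast
    moreover have "unit_seq k \<in> cylinder 0 k"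
      by (simp add: cylinder_def unit_seq_def)
    moreover have "unit_seq k \<noteq> 0"
      using zero_notin_ring_cylinder by (metis cylinder_self)
    ultimately show ?thesis
      using True by blast
  next
    case False
    then obtain i where i: "x \<in> ring_cylinder i"
      using ex_ring_cylinder by blast
    with x have "x \<in> K i"
      using glue_Int_ring_cylinder by blast
    then obtain y where y: "y \<in> K i" "y \<in> cylinder x (max k (Suc i))" "y \<noteq> x"
      using K[of i] by (auto simp: perfect_in_cantor_space_iff)
    moreover have "cylinder x (max k (Suc i)) \<subseteq> ring_cylinder i"
      using i by (rule cylinder_subset) simp
    moreover have "cylinder x (max k (Suc i)) \<subseteq> cylinder x k"
      by (rule cylinder_mono) simp
    ultimately show ?thesis
      using glue_Int_ring_cylinder[of K i] by blast
  qed
qed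

section \<open>Reducing countably many perfect sets to one\<close>

text \<open>
  The codes of the pairs of an index and a finite word enumerate all basic open pieces of all
  the sets \<open>P n\<close>; in each nonempty piece a point is picked.
\<close>

lemma ex_joint_dense_sequence:
  fixes P :: "nat \<Rightarrow> (nat \<Rightarrow> bit) set"
  assumes ne: "\<And>n. P n \<noteq> {}"
  obtains m :: "nat \<Rightarrow> nat" and x :: "nat \<Rightarrow> nat \<Rightarrow> bit"
  where "\<And>i. x i \<in> P (m i)"
    and "\<And>n y k. y \<in> P n \<Longrightarrow> \<exists>i. m i = n \<and> x i \<in> cylinder y k"
proof -
  define c :: "nat \<Rightarrow> nat \<times> bool list" where "c = from_nat"
  define word :: "nat \<Rightarrow> (nat \<Rightarrow> bit) set"
    where "word i = {z. \<forall>j<length (snd (c i)). z j = of_bool (snd (c i) ! j)}" for i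
  define m where "m i = fst (c i)" for i
  have "\<exists>z. z \<in> P (m i) \<and> (P (m i) \<inter> word i \<noteq> {} \<longrightarrow> z \<in> word i)" for i
    using ne[of "m i"] by blast
  then obtain x where x: "\<And>i. x i \<in> P (m i)"
      "\<And>i. P (m i) \<inter> word i \<noteq> {} \<Longrightarrow> x i \<in> word i"
    by metis
  show thesis
  proof
    show "x i \<in> P (m i)" for i by (rule x)
    fix n y k assume y: "y \<in> P n"
    obtain i where i: "c i = (n, map (\<lambda>j. y j = 1) [0..<k])"
      unfolding c_def by (metis from_nat_to_nat)
    have "of_bool (y j = 1) = y j" for j
      by (cases "y j") auto
    then have "word i = cylinder y k"
      by (auto simp: word_def cylinder_def i)
    moreover have "m i = n"
      by (simp add: m_def i)
    moreover have "x i \<in> word i"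
      using y x(2)[of i] calculation cylinder_self by blast
    ultimately show "\<exists>i. m i = n \<and> x i \<in> cylinder y k" by blast
  qed
qed

theorem theorem2p8:
  fixes A :: "(nat \<Rightarrow> bit) set"
  assumes "perfectly_meager_transitive A"
  shows "countably_perfectly_meager A"
  unfolding countably_perfectly_meager_def
proof (intro allI impI)
  fix P :: "nat \<Rightarrow> (nat \<Rightarrow> bit) set"
  assume P: "\<forall>n. perfect_in cantor_space (P n)"
  then have "\<And>n. P n \<noteq> {}"
    by (simp add: perfect_in_def)
  then obtain m :: "nat \<Rightarrow> nat" and x :: "nat \<Rightarrow> nat \<Rightarrow> bit"
    where x: "\<And>i. x i \<in> P (m i)"
    and dense: "\<And>n y k. y \<in> P n \<Longrightarrow> \<exists>i. m i = n \<and> x i \<in> cylinder y k"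
    by (rule ex_joint_dense_sequence[of P]) blast
  define t where "t i = x i + unit_seq i" for i
  define Q where "Q = glue (\<lambda>i. translate (P (m i)) (t i))"
  have x_t: "x i + t i = unit_seq i" for i
    unfolding t_def by (metis add.commute cantor_add_cancel)
  then have "unit_seq i + t i = x i" for i
    by (metis cantor_add_cancel)
  then have "perfect_in cantor_space Q"
    unfolding Q_def using P x by (intro perfect_in_glue perfect_in_translate)
      (auto simp: mem_translate_iff)
  then obtain F where F: "fsigma_in cantor_space F" "A \<subseteq> F"
    "\<And>s. meager_in (subtopology cantor_space (translate Q s)) (F \<inter> translate Q s)"
    using assms unfolding perfectly_meager_transitive_def by blast
  \<comment> \<open>Translating back by the same \<open>t i\<close> puts the \<open>i\<close>-th piece of \<open>Q\<close> in its original place.\<close>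
  have Q_ring: "Q \<inter> ring_cylinder i = translate (P (m i)) (t i) \<inter> ring_cylinder i" for i
    unfolding Q_def by (rule glue_Int_ring_cylinder)
  have piece: "translate Q (t i) \<inter> cylinder (x i) (Suc i) = P (m i) \<inter> cylinder (x i) (Suc i)" for i
  proof -
    have "y \<in> translate Q (t i) \<longleftrightarrow> y \<in> P (m i)" if "y \<in> cylinder (x i) (Suc i)" for y
    proof -
      have "y + t i \<in> ring_cylinder i"
        using that add_mem_cylinder_iff[of y "t i" "x i" "Suc i"] by (simp add: x_t)
      then have "y + t i \<in> Q \<longleftrightarrow> y + t i \<in> translate (P (m i)) (t i)"
        using Q_ring[of i] by blast
      then show ?thesis
        by (simp add: mem_translate_iff)
    qed
    then show ?thesis by blast
  qed
  have "meager_in (subtopology cantor_space (P n)) (F \<inter> P n)" for n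
  proof (rule meager_in_from_dense_cover[where I = "{i. m i = n}"
        and G = "\<lambda>i. P n \<inter> cylinder (x i) (Suc i)"])
    fix i assume "i \<in> {i. m i = n}"
    then have i: "m i = n" by simp
    show "openin (subtopology cantor_space (P n)) (P n \<inter> cylinder (x i) (Suc i))"
      by (simp add: openin_cylinder openin_subtopology_Int2)
    have "meager_in (subtopology cantor_space (P n))
        (F \<inter> translate Q (t i) \<inter> cylinder (x i) (Suc i))"
      using F(3) openin_cylinder piece[of i] unfolding i by (rule meager_in_local)
    moreover have "F \<inter> translate Q (t i) \<inter> cylinder (x i) (Suc i) =
        F \<inter> P n \<inter> (P n \<inter> cylinder (x i) (Suc i))"
      using piece[of i] i by blast
    ultimately show "meager_in (subtopology cantor_space (P n))
        (F \<inter> P n \<inter> (P n \<inter> cylinder (x i) (Suc i)))"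
      by simp
  next
    fix V assume "openin (subtopology cantor_space (P n)) V" "V \<noteq> {}"
    then obtain U y where U: "openin cantor_space U" "V = U \<inter> P n" and y: "y \<in> U" "y \<in> P n"
      by (auto simp: openin_subtopology)
    then obtain k where k: "cylinder y k \<subseteq> U"
      unfolding openin_cantor_space_iff by blast
    \<comment> \<open>A piece meets \<open>V\<close> as soon as its centre \<open>x i\<close> lies in \<open>V\<close>, however small it is.\<close>
    obtain i where i: "m i = n" "x i \<in> cylinder y k"
      using dense y by blast
    have "x i \<in> V \<inter> (P n \<inter> cylinder (x i) (Suc i))"
      using i k U x[of i] by auto
    with i show "\<exists>i\<in>{i. m i = n}. V \<inter> (P n \<inter> cylinder (x i) (Suc i)) \<noteq> {}"
      by blast
  qed auto
  with F show "\<exists>F. fsigma_in cantor_space F \<and> A \<subseteq> F \<and>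
      (\<forall>n. meager_in (subtopology cantor_space (P n)) (F \<inter> P n))"
    by blast
qed

end
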